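(* Let $G=Sp(2)$ and let $I=\mathrm{diag}(1,1)$, $P=\mathrm{diag}(-1,1)$. Then $\{\pm\Omega_G(I),\pm\Omega_G(P)\}$ is a categorical covering of $G$; that is, the four sets $\Omega_G(I)$, $-\Omega_G(I)=\Omega_G(-I)$, $\Omega_G(P)$, $-\Omega_G(P)=\Omega_G(-P)$ are categorical open subsets of $Sp(2)$ whose union is $Sp(2)$.
   Context: $Sp(2)=\{A\in\mathcal{M}(2,\mathbb{H})\colon AA^*=I\}$ is the group of $2\times2$ quaternionic matrices that are orthogonal with respect to the conjugate transpose $A^*$. For $A\in G=Sp(2)$, $\Omega_G(A)=\{X\in G\colon A+X \text{ is invertible}\}$. An open subset $U$ of a space $X$ is categorical when it is contractible in $X$ (the inclusion $U\hookrightarrow X$ is homotopic to a constant map). *)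

theory Defs
  imports "HOL-Analysis.Analysis"
begin

datatype quat = Quat (qRe: real) (qI: real) (qJ: real) (qK: real)

lemma quat_eq_iff:
  "x = y \<longleftrightarrow> qRe x = qRe y \<and> qI x = qI y \<and> qJ x = qJ y \<and> qK x = qK y"
  by (auto intro: quat.expand)

instantiation quat :: ring_1
begin

definition zero_quat :: quat where "0 = Quat 0 0 0 0"
definition one_quat :: quat where "1 = Quat 1 0 0 0"
definition plus_quat :: "quat \<Rightarrow> quat \<Rightarrow> quat" where
  "x + y = Quat (qRe x + qRe y) (qI x + qI y) (qJ x + qJ y) (qK x + qK y)"
definition uminus_quat :: "quat \<Rightarrow> quat" where
  "- x = Quat (- qRe x) (- qI x) (- qJ x) (- qK x)"
definition minus_quat :: "quat \<Rightarrow> quat \<Rightarrow> quat" where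
  "x - y = Quat (qRe x - qRe y) (qI x - qI y) (qJ x - qJ y) (qK x - qK y)"
definition times_quat :: "quat \<Rightarrow> quat \<Rightarrow> quat" where
  "x * y = Quat
    (qRe x * qRe y - qI x * qI y - qJ x * qJ y - qK x * qK y)
    (qRe x * qI y + qI x * qRe y + qJ x * qK y - qK x * qJ y)
    (qRe x * qJ y - qI x * qK y + qJ x * qRe y + qK x * qI y)
    (qRe x * qK y + qI x * qJ y - qJ x * qI y + qK x * qRe y)"

instance
  by standard
    (simp_all add: quat_eq_iff zero_quat_def one_quat_def plus_quat_def uminus_quat_def
      minus_quat_def times_quat_def algebra_simps)

end

lemma quat_sel [simp]:
  "qRe 0 = 0" "qI 0 = 0" "qJ 0 = 0" "qK 0 = 0"
  "qRe 1 = 1" "qI 1 = 0" "qJ 1 = 0" "qK 1 = 0"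
  "qRe (x + y) = qRe x + qRe y" "qI (x + y) = qI x + qI y"
  "qJ (x + y) = qJ x + qJ y" "qK (x + y) = qK x + qK y"
  "qRe (- x) = - qRe x" "qI (- x) = - qI x" "qJ (- x) = - qJ x" "qK (- x) = - qK x"
  "qRe (x - y) = qRe x - qRe y" "qI (x - y) = qI x - qI y"
  "qJ (x - y) = qJ x - qJ y" "qK (x - y) = qK x - qK y"
  "qRe (x * y) = qRe x * qRe y - qI x * qI y - qJ x * qJ y - qK x * qK y"
  "qI (x * y) = qRe x * qI y + qI x * qRe y + qJ x * qK y - qK x * qJ y"
  "qJ (x * y) = qRe x * qJ y - qI x * qK y + qJ x * qRe y + qK x * qI y"
  "qK (x * y) = qRe x * qK y + qI x * qJ y - qJ x * qI y + qK x * qRe y"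
  by (simp_all add: zero_quat_def one_quat_def plus_quat_def uminus_quat_def
      minus_quat_def times_quat_def)

definition qcnj :: "quat \<Rightarrow> quat" where
  "qcnj x = Quat (qRe x) (- qI x) (- qJ x) (- qK x)"

lemma qcnj_sel [simp]:
  "qRe (qcnj x) = qRe x" "qI (qcnj x) = - qI x" "qJ (qcnj x) = - qJ x" "qK (qcnj x) = - qK x"
  by (simp_all add: qcnj_def)

lemma qcnj_zero [simp]: "qcnj 0 = 0"
  by (simp add: quat_eq_iff)

lemma qcnj_mult: "qcnj (x * y) = qcnj y * qcnj x"
  by (simp add: quat_eq_iff algebra_simps)

lemma quat_units:
  "Quat 0 1 0 0 * Quat 0 1 0 0 = - 1"
  "Quat 0 0 1 0 * Quat 0 0 1 0 = - 1"
  "Quat 0 0 0 1 * Quat 0 0 0 1 = - 1"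
  "Quat 0 1 0 0 * Quat 0 0 1 0 = Quat 0 0 0 1"
  "Quat 0 0 1 0 * Quat 0 1 0 0 = - Quat 0 0 0 1"
  by (simp_all add: quat_eq_iff)

instantiation quat :: real_inner
begin

definition scaleR_quat :: "real \<Rightarrow> quat \<Rightarrow> quat" where
  "r *\<^sub>R x = Quat (r * qRe x) (r * qI x) (r * qJ x) (r * qK x)"
definition inner_quat :: "quat \<Rightarrow> quat \<Rightarrow> real" where
  "x \<bullet> y = qRe x * qRe y + qI x * qI y + qJ x * qJ y + qK x * qK y"
definition norm_quat :: "quat \<Rightarrow> real" where
  "norm x = sqrt (x \<bullet> x)" for x :: quat
definition sgn_quat :: "quat \<Rightarrow> quat" where
  "sgn x = inverse (norm x) *\<^sub>R x" for x :: quat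
definition dist_quat :: "quat \<Rightarrow> quat \<Rightarrow> real" where
  "dist x y = norm (x - y)" for x y :: quat
definition uniformity_quat :: "(quat \<times> quat) filter" where
  "uniformity = (INF e\<in>{0<..}. principal {(x :: quat, y). dist x y < e})"
definition open_quat :: "quat set \<Rightarrow> bool" where
  "open U \<longleftrightarrow> (\<forall>x\<in>U. eventually (\<lambda>(x', y). x' = x \<longrightarrow> y \<in> U) uniformity)" for U :: "quat set"

instance
proof
  fix x y z :: quat and r s :: real and U :: "quat set"
  show "r *\<^sub>R (x + y) = r *\<^sub>R x + r *\<^sub>R y" "(r + s) *\<^sub>R x = r *\<^sub>R x + s *\<^sub>R x"
    "r *\<^sub>R s *\<^sub>R x = (r * s) *\<^sub>R x" "1 *\<^sub>R x = x"
    by (simp_all add: quat_eq_iff scaleR_quat_def algebra_simps)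
  show "x \<bullet> y = y \<bullet> x" "(x + y) \<bullet> z = x \<bullet> z + y \<bullet> z" "(r *\<^sub>R x) \<bullet> y = r * (x \<bullet> y)" "0 \<le> x \<bullet> x"
    by (simp_all add: inner_quat_def scaleR_quat_def algebra_simps)
  show "x \<bullet> x = 0 \<longleftrightarrow> x = 0"
    by (simp add: inner_quat_def quat_eq_iff add_nonneg_eq_0_iff flip: power2_eq_square)
qed (simp_all only: norm_quat_def sgn_quat_def dist_quat_def uniformity_quat_def open_quat_def)

end

lemma scaleR_quat_sel [simp]:
  "qRe (r *\<^sub>R x) = r * qRe x" "qI (r *\<^sub>R x) = r * qI x"
  "qJ (r *\<^sub>R x) = r * qJ x" "qK (r *\<^sub>R x) = r * qK x"
  by (simp_all add: scaleR_quat_def)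

lemma norm_quat_power2: "(norm x)\<^sup>2 = (qRe x)\<^sup>2 + (qI x)\<^sup>2 + (qJ x)\<^sup>2 + (qK x)\<^sup>2" for x :: quat
  by (simp only: power2_norm_eq_inner inner_quat_def flip: power2_eq_square)

lemma quat_mult_qcnj: "x * qcnj x = (norm x)\<^sup>2 *\<^sub>R 1" "qcnj x * x = (norm x)\<^sup>2 *\<^sub>R 1"
  unfolding norm_quat_power2
  by (simp_all add: quat_eq_iff power2_eq_square algebra_simps)

lemma quat_scaleR_mult: "r *\<^sub>R x * y = r *\<^sub>R (x * y)" "x * r *\<^sub>R y = r *\<^sub>R (x * y)" for x y :: quat
  by (simp_all add: quat_eq_iff algebra_simps)

instantiation quat :: division_ring
begin

definition inverse_quat :: "quat \<Rightarrow> quat" where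
  "inverse x = (1 / (norm x)\<^sup>2) *\<^sub>R qcnj x"
definition divide_quat :: "quat \<Rightarrow> quat \<Rightarrow> quat" where
  "x div y = x * inverse y" for x y :: quat

instance
proof
  fix x y :: quat
  show "x \<noteq> 0 \<Longrightarrow> inverse x * x = 1" "x \<noteq> 0 \<Longrightarrow> x * inverse x = 1"
    by (simp_all add: inverse_quat_def quat_scaleR_mult quat_mult_qcnj)
  show "x div y = x * inverse y"
    by (simp add: divide_quat_def)
  show "inverse (0 :: quat) = 0"
    by (simp add: inverse_quat_def)
qed

end

instance quat :: real_normed_div_algebra
proof
  fix x y :: quat and r :: real
  show "r *\<^sub>R x * y = r *\<^sub>R (x * y)" "x * r *\<^sub>R y = r *\<^sub>R (x * y)"
    by (simp_all add: quat_scaleR_mult)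
  have "(norm (x * y))\<^sup>2 = (norm x * norm y)\<^sup>2"
    by (simp add: norm_quat_power2 power_mult_distrib) (simp add: power2_eq_square algebra_simps)
  then show "norm (x * y) = norm x * norm y"
    by (simp add: power2_eq_iff_nonneg)
qed

definition conj_transpose :: "quat^'n^'m \<Rightarrow> quat^'m^'n" where
  "conj_transpose A = (\<chi> i j. qcnj (A $ j $ i))"

definition diag2 :: "quat \<Rightarrow> quat \<Rightarrow> quat^2^2" where
  "diag2 a b = vector [vector [a, 0], vector [0, b]]"

definition Sp2 :: "(quat^2^2) set" where
  "Sp2 = {A. A ** conj_transpose A = mat 1}"

definition Omega :: "(quat^2^2) set \<Rightarrow> quat^2^2 \<Rightarrow> (quat^2^2) set" where
  "Omega G A = {X \<in> G. invertible (A + X)}"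

text \<open>Only the inclusion of \<open>U\<close> into the whole space is deformed to a constant map; the homotopy
  may leave \<open>U\<close>. This is weaker than contractibility of \<open>U\<close> as a space.\<close>

definition contractible_in :: "'a topology \<Rightarrow> 'a set \<Rightarrow> bool" where
  "contractible_in T U \<longleftrightarrow>
    (\<exists>c\<in>topspace T. homotopic_with (\<lambda>_. True) (subtopology T U) T (\<lambda>x. x) (\<lambda>_. c))"

definition categorical_in :: "'a topology \<Rightarrow> 'a set \<Rightarrow> bool" where
  "categorical_in T U \<longleftrightarrow> openin T U \<and> contractible_in T U"

definition categorical_covering :: "'a topology \<Rightarrow> 'a set set \<Rightarrow> bool" where
  "categorical_covering T \<U> \<longleftrightarrow> (\<forall>U\<in>\<U>. categorical_in T U) \<and> \<Union>\<U> = topspace T"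

lemma diag2_one: "diag2 1 1 = mat 1"
  by (simp add: diag2_def mat_def vec_eq_iff forall_2)

lemma diag2_in_Sp2:
  assumes "norm a = 1" "norm b = 1"
  shows "diag2 a b \<in> Sp2"
  using assms
  by (simp add: Sp2_def diag2_def conj_transpose_def mat_def matrix_matrix_mult_def vec_eq_iff
      forall_2 sum_2 quat_mult_qcnj)

end

theory Submission
  imports Defs
begin

text \<open>
  For a unitary \<open>X\<close> with \<open>1 + X\<close> invertible put \<open>K = (1 - X)(1 + X)\<^sup>-\<^sup>1\<close>, so that
  \<open>X = (1 - K)(1 + K)\<^sup>-\<^sup>1\<close>. Shrinking the skew-Hermitian matrix \<open>K\<close> to \<open>(1 - s)K\<close> deforms \<open>X\<close>
  to the identity through unitary matrices; clearing denominators, the path is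
  \<open>(s + (2 - s)X)((2 - s) + sX)\<^sup>-\<^sup>1\<close>. Left translation by \<open>A\<close> carries this to
  \<open>\<Omega>(A) = A \<Omega>(1)\<close>.
  If neither \<open>1 + X\<close> nor \<open>1 - X\<close> is invertible, then \<open>X\<close> has both eigenvalues \<open>1\<close> and \<open>-1\<close>, hence
  is Hermitian with diagonal of trace zero. Should this hold for \<open>PX\<close> as well, then the
  off-diagonal entries and the real parts of the diagonal entries vanish, which is impossible.
  Over the quaternions the usual determinant is replaced by that of the Hermitian matrix \<open>B B\<^sup>*\<close>.
\<close>

section \<open>Quaternionic conjugation and matrix algebra\<close>

lemma norm_qcnj [simp]: "norm (qcnj x) = norm x"
  by (rule power2_eq_imp_eq) (simp_all add: norm_quat_power2)

lemma qcnj_simps [simp]: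
  "qcnj (x + y) = qcnj x + qcnj y" "qcnj (- x) = - qcnj x" "qcnj (r *\<^sub>R x) = r *\<^sub>R qcnj x"
  "qcnj (qcnj x) = x" "qcnj 1 = 1"
  by (simp_all add: quat_eq_iff)

lemma bounded_linear_qcnj: "bounded_linear qcnj"
  by (rule bounded_linear_intro[where K = 1]) simp_all

lemma bounded_linear_qRe: "bounded_linear qRe"
proof (rule bounded_linear_intro[where K = 1])
  fix x :: quat
  have "\<bar>qRe x\<bar>\<^sup>2 \<le> (norm x)\<^sup>2"
    by (simp add: norm_quat_power2)
  then show "norm (qRe x) \<le> norm x * 1"
    by (simp flip: abs_le_square_iff)
qed simp_all

lemmas continuous_on_qcnj [continuous_intros] =
  bounded_linear.continuous_on[OF bounded_linear_qcnj]
lemmas continuous_on_qRe [continuous_intros] =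
  bounded_linear.continuous_on[OF bounded_linear_qRe]

lemma conj_transpose_nth [simp]: "conj_transpose A $ i $ j = qcnj (A $ j $ i)"
  by (simp add: conj_transpose_def)

lemma conj_transpose_simps [simp]:
  "conj_transpose (A + B) = conj_transpose A + conj_transpose B"
  "conj_transpose (- A) = - conj_transpose A"
  "conj_transpose (r *\<^sub>R A) = r *\<^sub>R conj_transpose A"
  "conj_transpose (conj_transpose A) = A"
  by (simp_all add: vec_eq_iff)

lemma conj_transpose_mat_1 [simp]: "conj_transpose (mat 1) = mat 1"
  by (auto simp: vec_eq_iff mat_def)

lemma qcnj_sum: "qcnj (sum f S) = (\<Sum>i\<in>S. qcnj (f i))"
  by (rule linear_sum[OF bounded_linear.linear[OF bounded_linear_qcnj]])

lemma conj_transpose_mult: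
  "conj_transpose (A ** B) = conj_transpose B ** conj_transpose A"
  by (simp add: vec_eq_iff matrix_matrix_mult_def qcnj_sum qcnj_mult)

lemma matrix_mult_minus:
  fixes A :: "'a::ring_1^'n^'m"
  shows "(- A) ** B = - (A ** B)" "A ** (- B) = - (A ** B)"
  by (simp_all add: vec_eq_iff matrix_matrix_mult_def sum_negf)

lemma continuous_on_matrix_mult [continuous_intros]:
  fixes f :: "'a::topological_space \<Rightarrow> 'b::real_normed_algebra_1^'n^'m"
  assumes "continuous_on S f" "continuous_on S g"
  shows "continuous_on S (\<lambda>x. f x ** g x)"
  unfolding matrix_matrix_mult_def by (intro continuous_intros assms)

lemma continuous_on_conj_transpose [continuous_intros]:
  assumes "continuous_on S f"
  shows "continuous_on S (\<lambda>x. conj_transpose (f x))"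
  unfolding conj_transpose_def by (intro continuous_intros assms)

section \<open>Determinants and inverses through Hermitian matrices\<close>

text \<open>Determinant and adjugate (trace minus matrix) of a Hermitian matrix; for other matrices
  they have no meaning.\<close>

definition hdet :: "quat^2^2 \<Rightarrow> real" where
  "hdet H = qRe (H $ 1 $ 1) * qRe (H $ 2 $ 2) - (norm (H $ 1 $ 2))\<^sup>2"

definition hadj :: "quat^2^2 \<Rightarrow> quat^2^2" where
  "hadj H = (qRe (H $ 1 $ 1) + qRe (H $ 2 $ 2)) *\<^sub>R mat 1 - H"

definition gram :: "quat^2^2 \<Rightarrow> quat^2^2" where
  "gram B = B ** conj_transpose B"

text \<open>The inverse of \<open>B\<close> is \<open>conj_transpose B\<close> times the inverse of
  the Hermitian matrix \<open>gram B\<close>. Being explicit, the formula is continuous wherever its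
  denominator is nonzero.\<close>

definition qinv :: "quat^2^2 \<Rightarrow> quat^2^2" where
  "qinv B = (1 / hdet (gram B)) *\<^sub>R (conj_transpose B ** hadj (gram B))"

lemma conj_transpose_gram: "conj_transpose (gram B) = gram B"
  by (simp add: gram_def conj_transpose_mult)

text \<open>Cayley-Hamilton survives noncommutativity here: the diagonal entries are real, hence
  central, and the off-diagonal entries are conjugate, hence commute.\<close>

lemma hadj_mult:
  assumes "conj_transpose H = H"
  shows "H ** hadj H = hdet H *\<^sub>R mat 1"
proof -
  have "qcnj (H $ 1 $ 1) = H $ 1 $ 1" "qcnj (H $ 2 $ 2) = H $ 2 $ 2"
    and c: "H $ 2 $ 1 = qcnj (H $ 1 $ 2)"
    using assms by (metis conj_transpose_nth)+
  then have "qI (H $ 1 $ 1) = 0" "qJ (H $ 1 $ 1) = 0" "qK (H $ 1 $ 1) = 0"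
    "qI (H $ 2 $ 2) = 0" "qJ (H $ 2 $ 2) = 0" "qK (H $ 2 $ 2) = 0"
    by (simp_all add: quat_eq_iff)
  then show ?thesis
    by (simp add: hadj_def hdet_def vec_eq_iff forall_2 matrix_matrix_mult_def sum_2 mat_def c
        quat_eq_iff norm_quat_power2) (simp add: power2_eq_square algebra_simps)
qed

text \<open>This symmetry makes the one-sided inverse given by the adjugate two-sided.\<close>

lemma hdet_gram_conj_transpose: "hdet (gram (conj_transpose B)) = hdet (gram B)"
  unfolding hdet_def gram_def
  by (simp add: matrix_matrix_mult_def sum_2 norm_quat_power2) algebra

lemma gram_diag:
  "gram B $ i $ i = ((norm (B $ i $ 1))\<^sup>2 + (norm (B $ i $ 2))\<^sup>2) *\<^sub>R 1"
  by (simp add: gram_def matrix_matrix_mult_def sum_2 quat_mult_qcnj scaleR_left_distrib)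

text \<open>Cauchy-Schwarz for the two rows of \<open>B\<close>, reduced to the norms of the entries
  and the two-square identity.\<close>

lemma hdet_gram_nonneg: "hdet (gram B) \<ge> 0"
proof -
  let ?a = "norm (B $ 1 $ 1)" and ?b = "norm (B $ 1 $ 2)" and ?c = "norm (B $ 2 $ 1)"
    and ?d = "norm (B $ 2 $ 2)"
  have "norm (gram B $ 1 $ 2) \<le> ?a * ?c + ?b * ?d"
    by (auto simp: gram_def matrix_matrix_mult_def sum_2 norm_mult intro!: norm_triangle_le)
  then have "(norm (gram B $ 1 $ 2))\<^sup>2 \<le> (?a * ?c + ?b * ?d)\<^sup>2"
    by (intro power_mono) auto
  also have "\<dots> \<le> (?a\<^sup>2 + ?b\<^sup>2) * (?c\<^sup>2 + ?d\<^sup>2)"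
  proof -
    have "(?a\<^sup>2 + ?b\<^sup>2) * (?c\<^sup>2 + ?d\<^sup>2) = (?a * ?c + ?b * ?d)\<^sup>2 + (?a * ?d - ?b * ?c)\<^sup>2"
      by algebra
    then show ?thesis by simp
  qed
  finally show ?thesis
    by (simp add: hdet_def gram_diag)
qed

lemma qinv_inverse:
  assumes "hdet (gram B) \<noteq> 0"
  shows "B ** qinv B = mat 1" "qinv B ** B = mat 1"
proof -
  have right: "C ** qinv C = mat 1" if "hdet (gram C) \<noteq> 0" for C
    using that hadj_mult[OF conj_transpose_gram, of C]
    by (simp add: qinv_def matrix_scalar_ac matrix_mul_assoc flip: gram_def scalar_matrix_assoc)
  show 1: "B ** qinv B = mat 1"
    by (rule right[OF assms])
  \<comment> \<open>Conjugate transposition turns a right inverse of \<open>conj_transpose B\<close>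
    into a left inverse of \<open>B\<close>.\<close>
  have "conj_transpose B ** qinv (conj_transpose B) = mat 1"
    by (rule right) (simp add: assms hdet_gram_conj_transpose)
  from arg_cong[OF this, of conj_transpose]
  obtain L where "L ** B = mat 1"
    by (auto simp: conj_transpose_mult)
  with 1 show "qinv B ** B = mat 1"
    by (metis matrix_mul_assoc matrix_mul_lid matrix_mul_rid)
qed

lemma invertible_iff_hdet_gram: "invertible B \<longleftrightarrow> hdet (gram B) \<noteq> 0"
proof
  assume "invertible B"
  then obtain C where C: "B ** C = mat 1" "C ** B = mat 1"
    by (auto simp: invertible_def)
  have "(conj_transpose C ** C) ** gram B = conj_transpose C ** (C ** B) ** conj_transpose B"
    by (simp add: gram_def matrix_mul_assoc)
  then have L: "(conj_transpose C ** C) ** gram B = mat 1"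
    by (simp add: C flip: conj_transpose_mult)
  show "hdet (gram B) \<noteq> 0"
  proof
    assume "hdet (gram B) = 0"
    then have "gram B ** hadj (gram B) = 0"
      by (simp add: hadj_mult conj_transpose_gram)
    then have "hadj (gram B) = 0"
      using L by (metis matrix_mul_assoc matrix_mul_lid times0_right)
    \<comment> \<open>A vanishing adjugate makes \<open>gram B\<close> equal to its trace times the
      identity, so each diagonal entry is the sum of both and all entries vanish.\<close>
    then have "gram B = 0"
      by (auto simp: vec_eq_iff forall_2 hadj_def mat_def quat_eq_iff)
    with L have "mat 1 = (0 :: quat^2^2)"
      by simp
    then show False
      by (simp add: vec_eq_iff forall_2 mat_def)
  qed
qed (auto simp: invertible_def dest: qinv_inverse)


section \<open>The group structure of \<open>Sp2\<close>\<close>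

lemma invertible_uminus:
  fixes A :: "quat^2^2"
  shows "invertible A \<Longrightarrow> invertible (- A)"
  using scalar_invertible[of "-1" A] by simp

lemma matrix_mul_add_rdistrib:
  fixes A :: "'a::semiring_1^'n^'m"
  shows "(A + B) ** C = A ** C + B ** C"
  by (simp add: vec_eq_iff matrix_matrix_mult_def distrib_right sum.distrib)

lemma Sp2_iff_gram: "A \<in> Sp2 \<longleftrightarrow> gram A = mat 1"
  by (simp add: Sp2_def gram_def)

lemma hdet_mat_1: "hdet (mat 1) = 1"
  by (simp add: hdet_def mat_def)

text \<open>Unitarity provides only a right inverse. Since \<open>hdet (gram A) = 1\<close>,
  \<open>qinv A\<close> is a left inverse, and the two must agree.\<close>

lemma Sp2_inverse:
  assumes "A \<in> Sp2"
  shows "A ** conj_transpose A = mat 1" "conj_transpose A ** A = mat 1"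
proof -
  show 1: "A ** conj_transpose A = mat 1"
    using assms by (simp add: Sp2_def)
  have "hdet (gram A) \<noteq> 0"
    using assms by (simp add: Sp2_iff_gram hdet_mat_1)
  then show "conj_transpose A ** A = mat 1"
    using 1 qinv_inverse(2)[of A] by (metis matrix_mul_assoc matrix_mul_lid matrix_mul_rid)
qed

lemma Sp2_conj_transpose: "A \<in> Sp2 \<Longrightarrow> conj_transpose A \<in> Sp2"
  using Sp2_inverse(2)[of A] by (simp add: Sp2_def)

lemma Sp2_uminus: "A \<in> Sp2 \<Longrightarrow> - A \<in> Sp2"
  by (simp add: Sp2_def matrix_mult_minus)

lemma gram_mult: "gram (A ** B) = A ** gram B ** conj_transpose A"
  by (simp add: gram_def conj_transpose_mult matrix_mul_assoc)

lemma Sp2_mult: "A \<in> Sp2 \<Longrightarrow> B \<in> Sp2 \<Longrightarrow> A ** B \<in> Sp2"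
  by (simp add: Sp2_iff_gram gram_mult) (simp add: gram_def)

section \<open>The pencil of \<open>mat 1\<close> and \<open>X\<close>, and the Cayley path\<close>

text \<open>As \<open>X\<close> is unitary, both Gram matrices are combinations of
  \<open>mat 1\<close> and \<open>X + conj_transpose X\<close>; the multiple of the latter is
  matched first.\<close>

lemma gram_Sp2_pencil:
  assumes "X \<in> Sp2"
  shows "gram (a *\<^sub>R mat 1 + b *\<^sub>R X) =
    (a * b) *\<^sub>R gram (mat 1 + X) + ((a - b)\<^sup>2) *\<^sub>R mat 1"
  using Sp2_inverse(1)[OF assms]
  by (simp add: gram_def matrix_add_ldistrib matrix_mul_add_rdistrib matrix_scalar_ac
      flip: scalar_matrix_assoc)
    (simp add: algebra_simps power2_eq_square flip: scaleR_add_left)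

lemma hdet_gram_Sp2_pencil_pos:
  assumes "X \<in> Sp2" "invertible (mat 1 + X)" "a \<ge> 0" "b \<ge> 0" "a + b > 0"
  shows "hdet (gram (a *\<^sub>R mat 1 + b *\<^sub>R X)) > 0"
proof -
  let ?M = "gram (mat 1 + X)"
  define T where "T = qRe (?M $ 1 $ 1) + qRe (?M $ 2 $ 2)"
  have T: "T \<ge> 0"
    by (simp add: T_def gram_diag)
  have M: "hdet ?M > 0"
    using hdet_gram_nonneg[of "mat 1 + X"] assms(2) by (simp add: invertible_iff_hdet_gram)
  \<comment> \<open>This is the quadratic \<open>det (p M + q) = p^2 det M + p q tr M + q^2\<close>
    with \<open>p = a * b\<close> and \<open>q = (a - b)^2\<close>. No term is negative; the first
    is positive if \<open>a = b\<close>, the last otherwise.\<close>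
  have eq: "hdet (gram (a *\<^sub>R mat 1 + b *\<^sub>R X)) =
      (a * b)\<^sup>2 * hdet ?M + (a * b) * (a - b)\<^sup>2 * T + ((a - b)\<^sup>2)\<^sup>2"
    unfolding gram_Sp2_pencil[OF assms(1)] hdet_def T_def
    by (simp add: mat_def power_mult_distrib) algebra
  show ?thesis
  proof (cases "a = b")
    case True
    then show ?thesis
      using assms M unfolding eq by simp
  next
    case False
    have "(a * b)\<^sup>2 * hdet ?M \<ge> 0" "(a * b) * (a - b)\<^sup>2 * T \<ge> 0"
      using assms M T by (auto intro!: mult_nonneg_nonneg)
    moreover have "((a - b)\<^sup>2)\<^sup>2 > 0"
      using False by simp
    ultimately show ?thesis
      unfolding eq by linarith
  qed
qed

definition cayley_path :: "real \<Rightarrow> quat^2^2 \<Rightarrow> quat^2^2" where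
  "cayley_path s X = (s *\<^sub>R mat 1 + (2 - s) *\<^sub>R X) ** qinv ((2 - s) *\<^sub>R mat 1 + s *\<^sub>R X)"

lemma cayley_path_Sp2:
  assumes "X \<in> Sp2" "invertible (mat 1 + X)" "s \<in> {0..1}"
  shows "cayley_path s X \<in> Sp2"
proof -
  define B where "B = (2 - s) *\<^sub>R mat 1 + s *\<^sub>R X"
  define N where "N = s *\<^sub>R mat 1 + (2 - s) *\<^sub>R X"
  have "hdet (gram B) \<noteq> 0"
    using hdet_gram_Sp2_pencil_pos[OF assms(1,2), of "2 - s" s] assms(3) by (simp add: B_def)
  note inv = qinv_inverse[OF this]
  have comm: "N ** B = B ** N"
    by (simp add: N_def B_def matrix_add_ldistrib matrix_mul_add_rdistrib matrix_scalar_ac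
      flip: scalar_matrix_assoc) (simp add: algebra_simps)
  \<comment> \<open>\<open>gram_mult\<close> only pulls out left factors, so the inverse has to be
    moved in front of \<open>N\<close>.\<close>
  have comm': "N ** qinv B = qinv B ** N"
    by (metis comm inv matrix_mul_assoc matrix_mul_lid matrix_mul_rid)
  \<comment> \<open>The pencil formula is symmetric in its two coefficients, and \<open>N\<close>
    and \<open>B\<close> differ by swapping them.\<close>
  have "gram N = gram B"
    unfolding N_def B_def gram_Sp2_pencil[OF assms(1)] by (simp add: algebra_simps power2_eq_square)
  then have "gram (qinv B ** N) = gram (qinv B ** B)"
    by (simp only: gram_mult)
  then show ?thesis
    unfolding cayley_path_def Sp2_iff_gram
    by (fold N_def B_def) (simp add: comm' inv, simp add: gram_def)
qed

lemma cayley_path_0: "cayley_path 0 X = X"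
proof -
  have "hdet (gram (2 *\<^sub>R mat 1)) \<noteq> 0"
    using scalar_invertible[of 2 "mat 1 :: quat^2^2"]
    by (auto simp: invertible_def simp flip: invertible_iff_hdet_gram)
  then have "2 *\<^sub>R mat 1 ** qinv (2 *\<^sub>R mat 1) = mat 1"
    by (rule qinv_inverse)
  then have "2 *\<^sub>R X ** qinv (2 *\<^sub>R mat 1) = X"
    by (metis matrix_mul_assoc matrix_mul_lid matrix_mul_rid matrix_scalar_ac scalar_matrix_assoc)
  then show ?thesis
    by (simp add: cayley_path_def)
qed

lemma cayley_path_1: "invertible (mat 1 + X) \<Longrightarrow> cayley_path 1 X = mat 1"
  by (simp add: cayley_path_def qinv_inverse invertible_iff_hdet_gram)

section \<open>Continuity of the determinant, adjugate and inverse\<close>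

lemma continuous_on_hdet_gram [continuous_intros]:
  assumes "continuous_on S f"
  shows "continuous_on S (\<lambda>x. hdet (gram (f x)))"
  unfolding hdet_def gram_def by (intro continuous_intros assms)

lemma continuous_on_hadj [continuous_intros]:
  assumes "continuous_on S f"
  shows "continuous_on S (\<lambda>x. hadj (f x))"
  unfolding hadj_def by (intro continuous_intros assms)

lemma continuous_on_qinv [continuous_intros]:
  assumes "continuous_on S f" "\<And>x. x \<in> S \<Longrightarrow> hdet (gram (f x)) \<noteq> 0"
  shows "continuous_on S (\<lambda>x. qinv (f x))"
  unfolding qinv_def using assms(2)
  by (intro continuous_intros assms) (auto simp: gram_def intro!: continuous_intros assms)

section \<open>The sets \<open>Omega Sp2 A\<close> are open and contractible in
  \<open>Sp2\<close>\<close>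

lemma Omega_Sp2_translate:
  assumes "A \<in> Sp2"
  shows "X \<in> Omega Sp2 A \<longleftrightarrow> X \<in> Sp2 \<and> invertible (mat 1 + conj_transpose A ** X)"
proof -
  have 1: "A + X = A ** (mat 1 + conj_transpose A ** X)"
    using Sp2_inverse[OF assms] by (simp add: matrix_add_ldistrib matrix_mul_assoc)
  have 2: "mat 1 + conj_transpose A ** X = conj_transpose A ** (A + X)"
    using Sp2_inverse[OF assms] by (simp add: matrix_add_ldistrib)
  have "invertible A" "invertible (conj_transpose A)"
    using Sp2_inverse[OF assms] by (auto simp: invertible_def)
  then show ?thesis
    unfolding Omega_def using 1 2 invertible_mult by (metis (no_types, lifting) mem_Collect_eq)
qed

lemma openin_Omega: "openin (top_of_set Sp2) (Omega Sp2 A)"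
proof -
  have "open {X. hdet (gram (A + X)) \<noteq> 0}"
    by (intro open_Collect_neq continuous_intros)
  moreover have "Omega Sp2 A = Sp2 \<inter> {X. hdet (gram (A + X)) \<noteq> 0}"
    by (auto simp: Omega_def invertible_iff_hdet_gram)
  ultimately show ?thesis
    by auto
qed

lemma contractible_in_Omega:
  assumes A: "A \<in> Sp2"
  shows "contractible_in (top_of_set Sp2) (Omega Sp2 A)"
proof -
  let ?U = "Omega Sp2 A"
  let ?h = "\<lambda>(s, X). A ** cayley_path s (conj_transpose A ** X)"
  have U: "conj_transpose A ** X \<in> Sp2" "invertible (mat 1 + conj_transpose A ** X)"
    if "X \<in> ?U" for X
    using that Omega_Sp2_translate[OF A] Sp2_mult[OF Sp2_conj_transpose[OF A]] by auto
  have "continuous_on ({0..1} \<times> ?U) ?h"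
    unfolding cayley_path_def case_prod_unfold
    \<comment> \<open>The weights \<open>2 - s\<close> and \<open>s\<close> are nonnegative with sum
      2, so the denominator of the path never degenerates.\<close>
    using hdet_gram_Sp2_pencil_pos[OF U]
    by (intro continuous_intros) (force simp: less_le)
  moreover have "?h \<in> {0..1} \<times> ?U \<rightarrow> Sp2"
    using U cayley_path_Sp2 Sp2_mult[OF A] by auto
  ultimately have "homotopic_with_canon (\<lambda>_. True) ?U Sp2 (\<lambda>X. X) (\<lambda>_. A)"
    using U Sp2_inverse[OF A]
    by (subst homotopic_with, simp)
      (auto intro!: exI[of _ ?h] simp: cayley_path_0 cayley_path_1 matrix_mul_assoc
        simp flip: subtopology_Times euclidean_product_topology)
  moreover have "Sp2 \<inter> ?U = ?U"
    by (auto simp: Omega_def)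
  ultimately show ?thesis
    using A by (auto simp: contractible_in_def subtopology_subtopology)
qed

lemma uminus_Omega: "uminus ` Omega Sp2 A = Omega Sp2 (- A)"
proof -
  have *: "- X \<in> Omega Sp2 (- B)" if "X \<in> Omega Sp2 B" for X B
    using that invertible_uminus[of "B + X"] by (simp add: Omega_def Sp2_uminus minus_diff_commute)
  show ?thesis
    using *[of _ A] *[of _ "- A"] by (force simp: image_iff)
qed

section \<open>The four sets cover \<open>Sp2\<close>\<close>

lemma hdet_gram_1_plus:
  assumes "X \<in> Sp2"
  shows "hdet (gram (mat 1 + X)) =
    (2 + 2 * qRe (X $ 1 $ 1)) * (2 + 2 * qRe (X $ 2 $ 2)) - (norm (X $ 1 $ 2 + qcnj (X $ 2 $ 1)))\<^sup>2"
proof -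
  have "gram (mat 1 + X) = mat 1 + X + conj_transpose X + mat 1"
    using Sp2_inverse(1)[OF assms]
    by (simp add: gram_def matrix_add_ldistrib matrix_mul_add_rdistrib)
  then show ?thesis
    by (simp add: hdet_def mat_def)
qed

text \<open>Both determinants vanish and share the same squared norm. Their difference makes the
  real trace zero, and either one then yields the value of that norm; unit row lengths force the
  rest.\<close>

lemma not_invertible_1_plus_minus:
  assumes X: "X \<in> Sp2" and "\<not> invertible (mat 1 + X)" "\<not> invertible (mat 1 + - X)"
  shows "qRe (X $ 2 $ 2) = - qRe (X $ 1 $ 1)" "X $ 1 $ 2 = qcnj (X $ 2 $ 1)"
    "(norm (X $ 1 $ 2 + qcnj (X $ 2 $ 1)))\<^sup>2 = 4 * (1 - (qRe (X $ 1 $ 1))\<^sup>2)"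
proof -
  let ?a = "qRe (X $ 1 $ 1)" and ?d = "qRe (X $ 2 $ 2)"
  let ?q = "X $ 1 $ 2" and ?r = "qcnj (X $ 2 $ 1)"
  have "(norm (- ?q + - ?r))\<^sup>2 = (norm (?q + ?r))\<^sup>2"
    by (metis minus_add_distrib norm_minus_cancel add.commute)
  then have e: "(2 + 2 * ?a) * (2 + 2 * ?d) - (norm (?q + ?r))\<^sup>2 = 0"
    "(2 - 2 * ?a) * (2 - 2 * ?d) - (norm (?q + ?r))\<^sup>2 = 0"
    using assms(2,3) hdet_gram_1_plus[OF X] hdet_gram_1_plus[OF Sp2_uminus[OF X]]
    by (simp_all add: invertible_iff_hdet_gram)
  then show d: "?d = - ?a"
    by (simp add: algebra_simps)
  then show n: "(norm (?q + ?r))\<^sup>2 = 4 * (1 - ?a\<^sup>2)"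
    using e by (simp add: algebra_simps power2_eq_square)
  have "gram X $ 1 $ 1 = 1" "gram X $ 2 $ 2 = 1"
    using X by (simp_all add: Sp2_iff_gram mat_def)
  then have rows: "(norm (X $ 1 $ 1))\<^sup>2 + (norm ?q)\<^sup>2 = 1"
    "(norm (X $ 2 $ 1))\<^sup>2 + (norm (X $ 2 $ 2))\<^sup>2 = 1"
    by (simp_all add: gram_diag quat_eq_iff)
  have "?a\<^sup>2 \<le> (norm (X $ 1 $ 1))\<^sup>2" "?d\<^sup>2 \<le> (norm (X $ 2 $ 2))\<^sup>2"
    by (simp_all add: norm_quat_power2)
  \<comment> \<open>The parallelogram law: \<open>?q + ?r\<close> is as long as the rows permit, so \<open>?q - ?r\<close> vanishes.\<close>
  moreover have "(norm (?q - ?r))\<^sup>2 + (norm (?q + ?r))\<^sup>2 = 2 * (norm ?q)\<^sup>2 + 2 * (norm ?r)\<^sup>2"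
    unfolding norm_quat_power2 by (simp add: power2_eq_square algebra_simps)
  ultimately have "(norm (?q - ?r))\<^sup>2 \<le> 0"
    using rows n unfolding d norm_qcnj power2_minus right_diff_distrib by linarith
  then show "?q = ?r"
    by simp
qed

theorem theorem7:
  fixes I P :: "quat^2^2"
  defines "I \<equiv> diag2 1 1" and "P \<equiv> diag2 (- 1) 1"
  shows "uminus ` Omega Sp2 I = Omega Sp2 (- I) \<and>
    uminus ` Omega Sp2 P = Omega Sp2 (- P) \<and>
    categorical_covering (top_of_set Sp2)
      {Omega Sp2 I, uminus ` Omega Sp2 I, Omega Sp2 P, uminus ` Omega Sp2 P}"
proof -
  have Sp2: "I \<in> Sp2" "P \<in> Sp2" "- I \<in> Sp2" "- P \<in> Sp2"
    by (simp_all add: I_def P_def diag2_in_Sp2 Sp2_uminus)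
  have "X \<in> Omega Sp2 I \<union> Omega Sp2 (- I) \<union> Omega Sp2 P \<union> Omega Sp2 (- P)" if X: "X \<in> Sp2" for X
  proof (rule ccontr)
    assume no: "\<not> ?thesis"
    let ?Y = "conj_transpose P ** X"
    have "?Y \<in> Sp2"
      using X Sp2 by (simp add: Sp2_mult Sp2_conj_transpose)
    moreover have "\<not> invertible (mat 1 + ?Y)" "\<not> invertible (mat 1 + - ?Y)"
      using no X Sp2 by (simp_all add: Omega_Sp2_translate matrix_mult_minus)
    ultimately have Y: "qRe (?Y $ 2 $ 2) = - qRe (?Y $ 1 $ 1)" "?Y $ 1 $ 2 = qcnj (?Y $ 2 $ 1)"
      by (rule not_invertible_1_plus_minus)+
    have "\<not> invertible (mat 1 + X)" "\<not> invertible (mat 1 + - X)"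
      using no X Sp2 by (simp_all add: Omega_Sp2_translate matrix_mult_minus I_def diag2_one)
    note XX = not_invertible_1_plus_minus[OF X this]
    have entries: "?Y $ 1 $ 1 = - X $ 1 $ 1" "?Y $ 1 $ 2 = - X $ 1 $ 2"
      "?Y $ 2 $ 1 = X $ 2 $ 1" "?Y $ 2 $ 2 = X $ 2 $ 2"
      by (simp_all add: P_def diag2_def matrix_matrix_mult_def sum_2)
    \<comment> \<open>Multiplication by \<open>conj_transpose P\<close> negates only the first row.
      The trace conditions for \<open>X\<close> and \<open>?Y\<close> thus have opposite signs, and
      the Hermitian condition for \<open>?Y\<close> makes the off-diagonal sum zero.\<close>
    have "qRe (X $ 1 $ 1) = 0" "X $ 1 $ 2 + qcnj (X $ 2 $ 1) = 0"
      using Y XX(1) unfolding entries by (simp_all add: add_eq_0_iff)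
    \<comment> \<open>The norm identity now reads \<open>0 = 4\<close>.\<close>
    with XX(3) show False
      by simp
  qed
  then have "Omega Sp2 I \<union> Omega Sp2 (- I) \<union> Omega Sp2 P \<union> Omega Sp2 (- P) = Sp2"
    by (auto simp: Omega_def)
  then show ?thesis
    using Sp2 by (simp add: uminus_Omega categorical_covering_def categorical_in_def openin_Omega
      contractible_in_Omega Un_assoc)
qed

end
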